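(* Let $n$ be a positive integer. The construction $\lambda\mapsto(\text{abacus diagram for }\lambda)$ described in the context is a bijection from the set of lecture hall partitions with $n$ parts to the set of abacus diagrams on $2n$ columns. Its inverse sends an abacus diagram with defining beads $b_1<b_2<\cdots<b_n$ to the sequence $\lambda=(\lambda_1,\ldots,\lambda_n)$ in which $\lambda_i$ is the number of $i$-active positions of the diagram, for each $1\le i\le n$.
   Context: Fix a positive integer $n$. A lecture hall partition with $n$ parts is a sequence of non-negative integers $\lambda=(\lambda_1,\ldots,\lambda_n)$ (zero parts allowed) with $0\le \lambda_1/1\le\lambda_2/2\le\cdots\le\lambda_n/n$. The array. Consider an array with $2n$ columns indexed $1,\ldots,2n$ and rows indexed by $\mathbb{Z}$; the entry (position) in row $i$ and column $j$ is labeled by the integer $j+2ni$. Thus positions are identified with the integers, and column $j$ is the residue class of $j$ modulo $2n$. Rows increase down the page. Reading order is the usual order on the integers. Column $j$ is dual to column $2n+1-j$ (so positions $p$ and $1-p$ lie in dual columns). Each position is designated either a bead or a gap. Abacus diagrams. A designation of all positions as beads or gaps is an abacus diagram (on $2n$ columns) if it is (1) flush: no bead in any column is preceded in reading order by a gap in the same column (that is, if $p$ is a bead then so is $p-2n$); and (2) balanced: for all $j\in\mathbb{Z}$, position $j$ is a bead if and only if position $1-j$ is a gap. The defining beads of an abacus diagram are the last (largest) $n$ beads, in reading order, among the set consisting of the lowest (largest) bead in each column; they are denoted $b_1<b_2<\cdots<b_n$. No two of them lie in the same column or in dual columns. Positions in the column containing $b_i$ or in its dual column are said to have class $i$. A position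 $p$ is $i$-active if $1\le p\le b_i$ and the class of $p$ is at most $i$. The abacus diagram for $\lambda$. Given a lecture hall partition $\lambda$ with $n$ parts, beads $b_n,b_{n-1},\ldots,b_1$ are placed successively. For $i=n,n-1,\ldots,1$: call a column available if it neither contains, nor is dual to a column containing, a previously placed bead $b_j$ with $j>i$. If $\lambda_i>0$, then $b_i$ is the $\lambda_i$-th smallest positive position lying in an available column (in particular $b_n=\lambda_n$ if $\lambda_n>0$). If $\lambda_i=0$, then $b_i$ is the largest non-positive position lying in an available column. Then, for each $i$, all positions above $b_i$ in its column (that is, $b_i-2n,b_i-4n,\ldots$) are also made beads, and so are the position $1-2n-b_i$, which lies in the dual column, and all positions above it in that column. All other positions are gaps. The resulting diagram is the abacus diagram for $\lambda$.
   Formalization: Abacus diagrams are additionally required to have a lowest bead in every column; flush and balanced alone also admit designations with a column all beads and its dual all gaps (n = 1, beads = odd integers), for which defining beads are undefined and the bijection fails. *)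

theory Defs
  imports Complex_Main "HOL-Library.FuncSet"
begin

text \<open>Sequences \<open>(\<lambda>\<^sub>1, \<dots>, \<lambda>\<^sub>n)\<close> are functions on \<open>{1..n}\<close>, extensional so that they can be compared
  by equality.\<close>

definition lecture_hall :: "nat \<Rightarrow> (nat \<Rightarrow> nat) set" where
  "lecture_hall n = {l \<in> {1..n} \<rightarrow>\<^sub>E UNIV.
     \<forall>i\<in>{1..<n}. real (l i) / real i \<le> real (l (i + 1)) / real (i + 1)}"

text \<open>Every position \<open>p\<close> is uniquely \<open>j + 2 n i\<close> with row \<open>i\<close> and column \<open>j \<in> {1..2 n}\<close>.\<close>

definition column :: "nat \<Rightarrow> int \<Rightarrow> int" where
  "column n p = (p - 1) mod (2 * int n) + 1"

definition dual_column :: "nat \<Rightarrow> int \<Rightarrow> int" where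
  "dual_column n c = 2 * int n + 1 - c"

text \<open>A designation of the positions as beads or gaps is given by its set \<open>B\<close> of beads.\<close>

definition flush :: "nat \<Rightarrow> int set \<Rightarrow> bool" where
  "flush n B \<longleftrightarrow> (\<forall>p. p \<in> B \<longrightarrow> p - 2 * int n \<in> B)"

definition balanced :: "int set \<Rightarrow> bool" where
  "balanced B \<longleftrightarrow> (\<forall>j. j \<in> B \<longleftrightarrow> 1 - j \<notin> B)"

definition lowest_beads :: "nat \<Rightarrow> int set \<Rightarrow> int set" where
  "lowest_beads n B = {p \<in> B. \<forall>q\<in>B. column n q = column n p \<longrightarrow> q \<le> p}"

text \<open>The last clause is implicit in the notion of defining beads, which needs every column to
  have a lowest bead.  It excludes degenerate designations that are flush and balanced, such as
  the one in which one column consists of beads only and its dual column of gaps only.\<close>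

definition abacus_diagrams :: "nat \<Rightarrow> int set set" where
  "abacus_diagrams n = {B. flush n B \<and> balanced B \<and>
     (\<forall>c\<in>{1..2 * int n}. \<exists>p\<in>lowest_beads n B. column n p = c)}"

definition defining_beads :: "nat \<Rightarrow> int set \<Rightarrow> int set" where
  "defining_beads n B =
     {p \<in> lowest_beads n B. card {q \<in> lowest_beads n B. p < q} < n}"

definition defining_bead :: "nat \<Rightarrow> int set \<Rightarrow> nat \<Rightarrow> int" where
  "defining_bead n B i = sorted_list_of_set (defining_beads n B) ! (i - 1)"

definition has_class :: "nat \<Rightarrow> int set \<Rightarrow> int \<Rightarrow> nat \<Rightarrow> bool" where
  "has_class n B p k \<longleftrightarrow> k \<in> {1..n} \<and>
     (column n p = column n (defining_bead n B k) \<or>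
      column n p = dual_column n (column n (defining_bead n B k)))"

definition active :: "nat \<Rightarrow> int set \<Rightarrow> nat \<Rightarrow> int \<Rightarrow> bool" where
  "active n B i p \<longleftrightarrow> 1 \<le> p \<and> p \<le> defining_bead n B i \<and> (\<exists>k\<le>i. has_class n B p k)"

definition kth_positive :: "int set \<Rightarrow> nat \<Rightarrow> int" where
  "kth_positive A k = (THE p. p \<in> A \<and> 0 < p \<and> card {q \<in> A. 0 < q \<and> q \<le> p} = k)"

definition largest_nonpositive :: "int set \<Rightarrow> int" where
  "largest_nonpositive A = (GREATEST p. p \<in> A \<and> p \<le> 0)"

text \<open>The bead \<open>b\<^sub>i\<close> placed for \<open>l\<close>; the set in the \<open>let\<close> consists of the positions in columns that
  are available once \<open>b\<^sub>n, \<dots>, b\<^sub>i\<^sub>+\<^sub>1\<close> have been placed.\<close>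

function placed_bead :: "nat \<Rightarrow> (nat \<Rightarrow> nat) \<Rightarrow> nat \<Rightarrow> int" where
  "placed_bead n l i =
     (let A = {p. \<forall>j\<in>{i<..n}. column n p \<noteq> column n (placed_bead n l j) \<and>
                               column n p \<noteq> dual_column n (column n (placed_bead n l j))}
      in if 0 < l i then kth_positive A (l i) else largest_nonpositive A)"
  by pat_completeness auto
termination by (relation "measure (\<lambda>(n, l, i). n - i)") auto

declare placed_bead.simps [simp del]

definition up_column :: "nat \<Rightarrow> int \<Rightarrow> int set" where
  "up_column n b = {p. column n p = column n b \<and> p \<le> b}"

definition abacus_of :: "nat \<Rightarrow> (nat \<Rightarrow> nat) \<Rightarrow> int set" where
  "abacus_of n l = (\<Union>i\<in>{1..n}. up_column n (placed_bead n l i) \<union>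
                              up_column n (1 - 2 * int n - placed_bead n l i))"

end

theory Submission
  imports Defs
begin

text \<open>Every block \<open>{t n + 1..(t + 1) n}\<close> contains exactly one position of each of the \<open>n\<close> classes
  of columns up to duality.  An abacus diagram amounts to a choice of one lowest bead
  \<open>\<ge> 1 - n\<close> in each class, that is, to its increasing sequence of defining beads.  Given
  \<open>b\<^sub>i\<^sub>+\<^sub>1, \<dots>, b\<^sub>n\<close>, the value \<open>\<lambda>\<^sub>i\<close> is the rank of \<open>b\<^sub>i\<close> among the positive positions of the
  remaining \<open>i\<close> classes.  Counting by blocks, the rank \<open>\<lambda>\<^sub>i\<close> drops to \<open>\<lambda>\<^sub>i - \<lceil>\<lambda>\<^sub>i / i\<rceil>\<close> once
  the class of \<open>b\<^sub>i\<close> is deleted, and therefore \<open>b\<^sub>i\<^sub>-\<^sub>1 < b\<^sub>i\<close> is equivalent to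
  \<open>\<lambda>\<^sub>i\<^sub>-\<^sub>1 \<le> \<lambda>\<^sub>i - \<lceil>\<lambda>\<^sub>i / i\<rceil>\<close>, which is the lecture hall condition.\<close>

section \<open>Classes of columns up to duality\<close>

text \<open>A zero-based column residue \<open>r\<close> and its dual residue
  \<open>2n - 1 - r\<close> have the same minimum, so this labels each dual pair of columns by a
  number below \<open>n\<close>, independently of any diagram.\<close>

definition pos_class :: "nat \<Rightarrow> int \<Rightarrow> int" where
  "pos_class n p = min ((p - 1) mod (2 * int n)) (2 * int n - 1 - (p - 1) mod (2 * int n))"

lemma pos_class_eq_iff:
  assumes "0 < n"
  shows "pos_class n p = pos_class n q \<longleftrightarrow>
    column n p = column n q \<or> column n p = dual_column n (column n q)"
proof -
  have "0 \<le> (x - 1) mod (2 * int n) \<and> (x - 1) mod (2 * int n) < 2 * int n" for x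
    using assms by simp
  from this[of p] this[of q] show ?thesis
    unfolding pos_class_def column_def dual_column_def by linarith
qed

lemma column_eq_iff: "column n p = column n q \<longleftrightarrow> 2 * int n dvd p - q"
  unfolding column_def by (simp add: mod_eq_dvd_iff)

lemma column_range: "0 < n \<Longrightarrow> column n p \<in> {1..2 * int n}"
proof -
  assume "0 < n"
  then have "0 \<le> (p - 1) mod (2 * int n) \<and> (p - 1) mod (2 * int n) < 2 * int n"
    by simp
  then show ?thesis unfolding column_def by simp
qed

lemma column_id: "c \<in> {1..2 * int n} \<Longrightarrow> column n c = c"
  unfolding column_def by (simp add: mod_pos_pos_trivial)

text \<open>The reflection \<open>1 - 2n - p\<close> used in the construction differs from
  \<open>1 - p\<close> by one period, hence lies in the column dual to that of
  \<open>p\<close>.\<close>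

lemma dual_column_column: "0 < n \<Longrightarrow> dual_column n (column n p) = column n (1 - 2 * int n - p)"
proof -
  assume n: "0 < n"
  have "dual_column n (column n p) \<in> {1..2 * int n}"
    using column_range[OF n, of p] unfolding dual_column_def by auto
  then have "dual_column n (column n p) = column n (dual_column n (column n p))"
    by (simp add: column_id)
  also have "\<dots> = column n (1 - 2 * int n - p)"
  proof -
    have "2 * int n dvd p - column n p"
      using column_id[OF column_range[OF n, of p]] column_eq_iff[of n p "column n p"] by simp
    then have "2 * int n dvd p - column n p + 2 * int n * 2" by (rule dvd_add) simp
    then show ?thesis
      unfolding column_eq_iff dual_column_def by (simp add: algebra_simps)
  qed
  finally show ?thesis .
qed

lemma pos_class_eq_dvd_iff:
  assumes "0 < n"
  shows "pos_class n p = pos_class n q \<longleftrightarrow> 2 * int n dvd p - q \<or> 2 * int n dvd p + q - 1"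
proof -
  have "2 * int n dvd p - (1 - 2 * int n - q) \<longleftrightarrow> 2 * int n dvd p + q - 1 + 2 * int n"
    by (simp add: algebra_simps)
  also have "\<dots> \<longleftrightarrow> 2 * int n dvd p + q - 1" by simp
  finally show ?thesis
    using assms by (simp add: pos_class_eq_iff dual_column_column column_eq_iff)
qed

lemma pos_class_reflect: "0 < n \<Longrightarrow> pos_class n (1 - 2 * int n - p) = pos_class n p"
  by (simp add: pos_class_eq_iff dual_column_column)

lemma pos_class_range: "0 < n \<Longrightarrow> pos_class n p \<in> {0..<int n}"
proof -
  assume n: "0 < n"
  then have "0 \<le> (p - 1) mod (2 * int n) \<and> (p - 1) mod (2 * int n) < 2 * int n"
    by simp
  then show ?thesis
    unfolding pos_class_def by auto
qed

text \<open>Inside a block, \<open>p - q\<close> is smaller than \<open>2n\<close> in absolute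
  value, and \<open>p + q - 1 - 2nt\<close> lies strictly between \<open>0\<close> and
  \<open>2n\<close>. So the first congruence for equal classes forces \<open>p = q\<close>, and the
  second is impossible. Counting gives surjectivity. The index \<open>t\<close> may be negative:
  \<open>t = -1\<close> is the block \<open>{1 - n..0}\<close>.\<close>

lemma pos_class_block:
  assumes n: "0 < n"
  shows "bij_betw (pos_class n) {t * int n<..(t + 1) * int n} {0..<int n}"
proof -
  have inj: "inj_on (pos_class n) {t * int n<..(t + 1) * int n}"
  proof (rule inj_onI)
    fix p q assume p: "p \<in> {t * int n<..(t + 1) * int n}" and q: "q \<in> {t * int n<..(t + 1) * int n}"
      and "pos_class n p = pos_class n q"
    then consider "2 * int n dvd p - q" | "2 * int n dvd p + q - 1"
      using pos_class_eq_dvd_iff[OF n] by blast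
    then show "p = q"
    proof cases
      case 1
      have "\<bar>p - q\<bar> < 2 * int n" using p q by (auto simp: algebra_simps)
      with 1 show ?thesis
        using dvd_imp_le_int[of "p - q" "2 * int n"] by linarith
    next
      case 2
      then have "2 * int n dvd p + q - 1 - 2 * int n * t" by (rule dvd_diff) simp
      moreover have "0 < p + q - 1 - 2 * int n * t" "p + q - 1 - 2 * int n * t < 2 * int n"
        using p q by (auto simp: algebra_simps)
      ultimately show ?thesis using zdvd_not_zless by blast
    qed
  qed
  moreover have "pos_class n ` {t * int n<..(t + 1) * int n} = {0..<int n}"
  proof (rule card_subset_eq)
    show "pos_class n ` {t * int n<..(t + 1) * int n} \<subseteq> {0..<int n}"
      using pos_class_range[OF n] by blast
    show "card (pos_class n ` {t * int n<..(t + 1) * int n}) = card {0..<int n}"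
      using inj by (simp add: card_image algebra_simps)
  qed simp
  ultimately show ?thesis by (simp add: bij_betw_def)
qed

section \<open>Ranks of positions among the positive positions of given classes\<close>

definition class_count :: "nat \<Rightarrow> int set \<Rightarrow> int \<Rightarrow> nat" where
  "class_count n K x = card {q. pos_class n q \<in> K \<and> 0 < q \<and> q \<le> x}"

lemma finite_class_count: "finite {q. pos_class n q \<in> K \<and> a < q \<and> q \<le> x}"
  by (rule finite_subset[of _ "{a..x}"]) auto

lemma class_count_split:
  assumes "0 \<le> a" "a \<le> b"
  shows "class_count n K b = class_count n K a + card {q. pos_class n q \<in> K \<and> a < q \<and> q \<le> b}"
proof -
  have "{q. pos_class n q \<in> K \<and> 0 < q \<and> q \<le> b} =
    {q. pos_class n q \<in> K \<and> 0 < q \<and> q \<le> a} \<union> {q. pos_class n q \<in> K \<and> a < q \<and> q \<le> b}"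
    using assms by auto
  then show ?thesis
    unfolding class_count_def by (simp add: card_Un_disjoint finite_class_count disjoint_iff)
qed

lemma class_count_mono: "a \<le> b \<Longrightarrow> class_count n K a \<le> class_count n K b"
  unfolding class_count_def by (rule card_mono[OF finite_class_count]) auto

lemma class_count_strict_mono:
  assumes "a < b" "0 < b" "pos_class n b \<in> K"
  shows "class_count n K a < class_count n K b"
  unfolding class_count_def
proof (rule psubset_card_mono[OF finite_class_count])
  let ?S = "\<lambda>x. {q. pos_class n q \<in> K \<and> 0 < q \<and> q \<le> x}"
  have "?S a \<subseteq> ?S b" "b \<in> ?S b" "b \<notin> ?S a" using assms by auto
  then show "?S a \<subset> ?S b" by blast
qed

lemma class_count_nonpos: "b \<le> 0 \<Longrightarrow> class_count n K b = 0"
  unfolding class_count_def by (auto simp: card_eq_0_iff)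

lemma card_class_block:
  assumes "0 < n" "K \<subseteq> {0..<int n}"
  shows "card {q. pos_class n q \<in> K \<and> t * int n < q \<and> q \<le> (t + 1) * int n} = card K"
proof -
  let ?S = "{q. pos_class n q \<in> K \<and> t * int n < q \<and> q \<le> (t + 1) * int n}"
  have "inj_on (pos_class n) ?S"
    by (rule inj_on_subset[OF bij_betw_imp_inj_on[OF pos_class_block[OF assms(1), of t]]]) auto
  moreover have "pos_class n ` ?S = K"
  proof -
    have "?S = {t * int n<..(t + 1) * int n} \<inter> pos_class n -` K" by auto
    then have "pos_class n ` ?S = pos_class n ` {t * int n<..(t + 1) * int n} \<inter> K" by blast
    then show ?thesis
      using bij_betw_imp_surj_on[OF pos_class_block[OF assms(1), of t]] assms(2) by auto
  qed
  ultimately show ?thesis by (metis card_image)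
qed

lemma class_count_blocks:
  assumes "0 < n" "K \<subseteq> {0..<int n}"
  shows "class_count n K (int t * int n) = t * card K"
proof (induction t)
  case 0
  show ?case by (simp add: class_count_nonpos)
next
  case (Suc t)
  have "int (Suc t) * int n = (int t + 1) * int n" by simp
  then show ?case
    using Suc class_count_split[of "int t * int n" "(int t + 1) * int n" n K]
      card_class_block[OF assms, of "int t"] by (simp add: algebra_simps)
qed

text \<open>The \<open>t\<close> full blocks before that of \<open>b\<close> contribute
  \<open>t * card K\<close>; \<open>b\<close> itself makes the lower bound strict, and its block
  adds at most \<open>card K\<close>.\<close>

lemma class_count_in_block:
  assumes n: "0 < n" and K: "K \<subseteq> {0..<int n}" and b: "pos_class n b \<in> K"
    and t: "int t * int n < b" "b \<le> (int t + 1) * int n"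
  shows "t * card K < class_count n K b" "class_count n K b \<le> (t + 1) * card K"
proof -
  have b0: "0 < b" using t(1) by (smt (verit) of_nat_0_le_iff zero_le_mult_iff)
  show "t * card K < class_count n K b"
    using class_count_strict_mono[OF t(1) b0 b] by (simp add: class_count_blocks[OF n K])
  show "class_count n K b \<le> (t + 1) * card K"
    using class_count_mono[OF t(2), of n K] class_count_blocks[OF n K, of "t + 1"]
    by (simp add: add.commute)
qed

lemma class_count_Diff:
  assumes "c \<in> K"
  shows "class_count n K b = class_count n (K - {c}) b + class_count n {c} b"
proof -
  have "{q. pos_class n q \<in> K \<and> 0 < q \<and> q \<le> b} =
    {q. pos_class n q \<in> K - {c} \<and> 0 < q \<and> q \<le> b} \<union> {q. pos_class n q \<in> {c} \<and> 0 < q \<and> q \<le> b}"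
    using assms by blast
  then show ?thesis
    unfolding class_count_def
    by (simp only:) (subst card_Un_disjoint, auto intro: finite_subset[of _ "{0..b}"])
qed

text \<open>If \<open>b > 0\<close> lies in the block \<open>{t n + 1..(t + 1) n}\<close>, its own class occurs \<open>t + 1\<close> times in
  \<open>{1..b}\<close>, and \<open>t + 1\<close> is the ceiling of \<open>k / i\<close> where \<open>k = class_count n K b\<close> and
  \<open>i = card K\<close>.  Hence deleting that class from \<open>K\<close> leaves \<open>k - \<lceil>k / i\<rceil>\<close> positions.\<close>

lemma class_count_delete_iff:
  assumes n: "0 < n" and K: "K \<subseteq> {0..<int n}" and b: "pos_class n b \<in> K"
  shows "m \<le> class_count n (K - {pos_class n b}) b \<longleftrightarrow>
    m * card K \<le> class_count n K b * (card K - 1)"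
proof (cases "0 < b")
  case False
  have "0 < card K" using K b by (metis card_gt_0_iff empty_iff finite_atLeastLessThan_int finite_subset)
  with False show ?thesis by (simp add: class_count_nonpos)
next
  case True
  \<comment> \<open>Blocks start at \<open>t n + 1\<close>, so the block index of \<open>b\<close>
    is the quotient of \<open>b - 1\<close>, not of \<open>b\<close>.\<close>
  define t where "t = nat ((b - 1) div int n)"
  have "int t = (b - 1) div int n" using True n unfolding t_def by (simp add: pos_imp_zdiv_nonneg_iff)
  then have "b - 1 = int t * int n + (b - 1) mod int n" by simp
  moreover have "0 \<le> (b - 1) mod int n" "(b - 1) mod int n < int n" using n by simp_all
  ultimately have t: "int t * int n < b" "b \<le> (int t + 1) * int n"
    unfolding distrib_right by linarith+
  define i k where "i = card K" and "k = class_count n K b"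
  have tk: "t * i < k" "k \<le> (t + 1) * i"
    using class_count_in_block[OF n K b t] by (simp_all add: i_def k_def)
  \<comment> \<open>For a single class the two block bounds are \<open>t < count\<close> and
    \<open>count \<le> t + 1\<close>, which fixes the count.\<close>
  have "class_count n {pos_class n b} b = t + 1"
    using class_count_in_block[OF n _ _ t, of "{pos_class n b}"] pos_class_range[OF n, of b] by auto
  then have k: "k = class_count n (K - {pos_class n b}) b + (t + 1)"
    unfolding k_def using class_count_Diff[OF b, of n b] by simp
  have "0 < i" using tk by (cases i) auto
  \<comment> \<open>Multiply by \<open>i\<close> and use \<open>k \<le> (t + 1) * i\<close> in one
    direction, \<open>t * i < k\<close> in the other. The additive form avoids truncated
    subtraction.\<close>
  have "m + (t + 1) \<le> k \<longleftrightarrow> m * i + k \<le> k * i"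
  proof
    assume "m + (t + 1) \<le> k"
    then have "(m + (t + 1)) * i \<le> k * i" by (rule mult_le_mono1)
    then show "m * i + k \<le> k * i" using tk(2) by (simp add: algebra_simps)
  next
    assume "m * i + k \<le> k * i"
    then have "(m + t) * i < k * i" using tk(1) by (simp add: algebra_simps)
    then show "m + (t + 1) \<le> k" by simp
  qed
  moreover have "m * i + k \<le> k * i \<longleftrightarrow> m * i \<le> k * (i - 1)"
    using \<open>0 < i\<close> by (cases i) (auto simp: algebra_simps)
  ultimately show ?thesis using k by (simp add: i_def k_def)
qed

section \<open>The two placement rules\<close>

lemma kth_positive_eqI:
  assumes "pos_class n p \<in> K" "0 < p" "class_count n K p = k"
  shows "kth_positive {q. pos_class n q \<in> K} k = p"
  unfolding kth_positive_def
proof (rule the_equality)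
  show "p \<in> {q. pos_class n q \<in> K} \<and> 0 < p \<and>
      card {q \<in> {q. pos_class n q \<in> K}. 0 < q \<and> q \<le> p} = k"
    using assms by (simp add: class_count_def)
next
  fix r assume "r \<in> {q. pos_class n q \<in> K} \<and> 0 < r \<and>
      card {q \<in> {q. pos_class n q \<in> K}. 0 < q \<and> q \<le> r} = k"
  then have r: "pos_class n r \<in> K" "0 < r" "class_count n K r = k"
    by (simp_all add: class_count_def)
  then show "r = p"
    using class_count_strict_mono[of r p n K] class_count_strict_mono[of p r n K] assms
    by (metis less_irrefl linorder_neqE)
qed

text \<open>The first \<open>k\<close> blocks contain at least \<open>k\<close> positions of
  \<open>K\<close>, so a least \<open>m\<close> of rank at least \<open>k\<close> exists. The rank
  grows by at most one per position, and only at positions of \<open>K\<close>; hence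
  \<open>m\<close> has class in \<open>K\<close> and rank exactly \<open>k\<close>.\<close>

lemma kth_positive_spec:
  assumes n: "0 < n" and K: "K \<subseteq> {0..<int n}" "K \<noteq> {}" and k: "0 < k"
  defines "p \<equiv> kth_positive {q. pos_class n q \<in> K} k"
  shows "pos_class n p \<in> K" "0 < p" "class_count n K p = k"
proof -
  have "0 < card K" using K by (metis card_gt_0_iff finite_atLeastLessThan_int finite_subset)
  then have ex: "k \<le> class_count n K (int (k * n))"
    using class_count_blocks[OF n K(1), of k] by simp
  define m where "m = (LEAST m. k \<le> class_count n K (int m))"
  have m: "k \<le> class_count n K (int m)" unfolding m_def using ex by (rule LeastI)
  have m0: "0 < m" using m k by (cases m) (auto simp: class_count_nonpos)
  then have less: "class_count n K (int m - 1) < k"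
    using not_less_Least[of "m - 1" "\<lambda>m. k \<le> class_count n K (int m)"] unfolding m_def[symmetric]
    by (simp add: of_nat_diff)
  have split: "class_count n K (int m) = class_count n K (int m - 1) +
      card {q. pos_class n q \<in> K \<and> int m - 1 < q \<and> q \<le> int m}"
    using m0 by (intro class_count_split) auto
  have sub: "{q. pos_class n q \<in> K \<and> int m - 1 < q \<and> q \<le> int m} =
      (if pos_class n (int m) \<in> K then {int m} else {})"
  proof -
    have "int m - 1 < q \<and> q \<le> int m \<longleftrightarrow> q = int m" for q by auto
    then show ?thesis by auto
  qed
  have *: "pos_class n (int m) \<in> K" "class_count n K (int m) = k"
    using split sub less m by (auto split: if_splits)
  then have "p = int m" unfolding p_def using m0 by (intro kth_positive_eqI) auto
  then show "pos_class n p \<in> K" "0 < p" "class_count n K p = k" using * m0 by auto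
qed

lemma largest_nonpositive_eqI:
  assumes "p \<in> A" "p \<le> 0" "\<And>q. q \<in> A \<Longrightarrow> q \<le> 0 \<Longrightarrow> q \<le> p"
  shows "largest_nonpositive A = p"
  unfolding largest_nonpositive_def using assms by (intro Greatest_equality) auto

text \<open>Every class occurs in the block \<open>{1 - n..0}\<close>, so the maximum over that
  block is the maximum over all non-positive positions. This is the source of the lower bound
  \<open>1 - n\<close> on beads.\<close>

lemma largest_nonpositive_spec:
  assumes n: "0 < n" and K: "K \<subseteq> {0..<int n}" "K \<noteq> {}"
  defines "p \<equiv> largest_nonpositive {q. pos_class n q \<in> K}"
  shows "pos_class n p \<in> K" "1 - int n \<le> p" "p \<le> 0"
    "\<And>q. pos_class n q \<in> K \<Longrightarrow> q \<le> 0 \<Longrightarrow> q \<le> p"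
proof -
  let ?S = "{q \<in> {- int n<..0}. pos_class n q \<in> K}"
  have "bij_betw (pos_class n) {- int n<..0} {0..<int n}"
    using pos_class_block[OF n, of "-1"] by simp
  then have "K \<subseteq> pos_class n ` {- int n<..0}" using K(1) by (simp add: bij_betw_def)
  then have ne: "?S \<noteq> {}" using K(2) by blast
  have fin: "finite ?S" by (rule finite_subset[of _ "{- int n<..0}"]) auto
  have M: "Max ?S \<in> ?S" using fin ne by (rule Max_in)
  have max: "q \<le> Max ?S" if "pos_class n q \<in> K" "q \<le> 0" for q
  proof (cases "- int n < q")
    case True
    then show ?thesis using that fin by (intro Max_ge) auto
  next
    case False
    then show ?thesis using M by auto
  qed
  have "p = Max ?S" unfolding p_def using M max by (intro largest_nonpositive_eqI) auto
  then show "pos_class n p \<in> K" "1 - int n \<le> p" "p \<le> 0"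
    "\<And>q. pos_class n q \<in> K \<Longrightarrow> q \<le> 0 \<Longrightarrow> q \<le> p"
    using M max by auto
qed

section \<open>Bead sequences and lecture hall partitions\<close>

text \<open>These turn out to be the sequences of defining beads of abacus diagrams. Dual lowest
  beads have sum \<open>1 - 2n\<close>, so exactly one of them is at least
  \<open>1 - n\<close>.\<close>

definition bead_sequence :: "nat \<Rightarrow> (nat \<Rightarrow> int) \<Rightarrow> bool" where
  "bead_sequence n b \<longleftrightarrow> strict_mono_on {1..n} b \<and>
     bij_betw (\<lambda>i. pos_class n (b i)) {1..n} {0..<int n} \<and> (\<forall>i\<in>{1..n}. 1 - int n \<le> b i)"

text \<open>Labels of the columns available when \<open>b i\<close> is placed; only beads of index
  above \<open>i\<close> enter, which suits downward induction.\<close>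

definition free_classes :: "nat \<Rightarrow> (nat \<Rightarrow> int) \<Rightarrow> nat \<Rightarrow> int set" where
  "free_classes n b i = {0..<int n} - (\<lambda>j. pos_class n (b j)) ` {i<..n}"

lemma free_classes_subset: "free_classes n b i \<subseteq> {0..<int n}"
  unfolding free_classes_def by blast

lemma placed_bead_eq:
  assumes n: "0 < n"
  shows "placed_bead n l i =
    (let A = {p. pos_class n p \<in> free_classes n (placed_bead n l) i}
     in if 0 < l i then kth_positive A (l i) else largest_nonpositive A)"
proof -
  have "{p. \<forall>j\<in>{i<..n}. column n p \<noteq> column n (placed_bead n l j) \<and>
            column n p \<noteq> dual_column n (column n (placed_bead n l j))} =
        {p. pos_class n p \<in> free_classes n (placed_bead n l) i}"
    unfolding free_classes_def using pos_class_range[OF n] pos_class_eq_iff[OF n] by blast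
  then show ?thesis by (subst placed_bead.simps) (simp only:)
qed

lemma card_free_classes:
  assumes "inj_on (\<lambda>i. pos_class n (b i)) {1..n}" "0 < n" "i \<le> n"
  shows "card (free_classes n b i) = i"
proof -
  have "card ((\<lambda>j. pos_class n (b j)) ` {i<..n}) = n - i"
    using inj_on_subset[OF assms(1), of "{i<..n}"] by (simp add: card_image subset_iff)
  then show ?thesis
    unfolding free_classes_def using pos_class_range[OF assms(2)] assms(3)
    by (subst card_Diff_subset) auto
qed

lemma free_classes_Suc:
  assumes "Suc i \<le> n"
  shows "free_classes n b i = free_classes n b (Suc i) - {pos_class n (b (Suc i))}"
proof -
  have "{i<..n} = insert (Suc i) {Suc i<..n}" using assms by auto
  then show ?thesis unfolding free_classes_def by auto
qed

text \<open>Cross-multiplication gives the inequality of \<open>class_count_delete_iff\<close> for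
  \<open>card K = Suc i\<close>.\<close>

lemma lecture_hall_iff:
  "l \<in> lecture_hall n \<longleftrightarrow> l \<in> extensional {1..n} \<and>
     (\<forall>i. 1 \<le> i \<longrightarrow> Suc i \<le> n \<longrightarrow> l i * Suc i \<le> l (Suc i) * i)"
proof -
  have *: "real a / real i \<le> real c / real (i + 1) \<longleftrightarrow> a * Suc i \<le> c * i" if "1 \<le> i" for a c i
  proof -
    have "real a / real i \<le> real c / real (i + 1) \<longleftrightarrow> real (a * Suc i) \<le> real (c * i)"
      using that by (simp add: divide_simps distrib_left)
    then show ?thesis by (simp only: of_nat_le_iff)
  qed
  show ?thesis
    unfolding lecture_hall_def using * by (auto simp: PiE_def)
qed

text \<open>Later beads occupy at most \<open>n - i\<close> labels, so a free label remains and both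
  placement rules succeed. A non-positive bead has rank \<open>0\<close>, so the rank equation
  covers \<open>l i = 0\<close> too.\<close>

lemma placed_bead_spec:
  fixes n :: nat and l :: "nat \<Rightarrow> nat"
  assumes n: "0 < n" and i: "1 \<le> i" "i \<le> n"
  defines "b \<equiv> placed_bead n l"
  shows "pos_class n (b i) \<in> free_classes n b i" "class_count n (free_classes n b i) (b i) = l i"
    "1 - int n \<le> b i" "0 < l i \<longleftrightarrow> 0 < b i"
    "\<And>q. l i = 0 \<Longrightarrow> pos_class n q \<in> free_classes n b i \<Longrightarrow> q \<le> 0 \<Longrightarrow> q \<le> b i"
proof -
  let ?K = "free_classes n b i"
  have "card ((\<lambda>j. pos_class n (b j)) ` {i<..n}) \<le> n - i"
    using card_image_le[of "{i<..n}" "\<lambda>j. pos_class n (b j)"] by simp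
  then have "card ((\<lambda>j. pos_class n (b j)) ` {i<..n}) < card {0..<int n}" using i by simp
  then have ne: "?K \<noteq> {}"
    unfolding free_classes_def using card_mono[of "(\<lambda>j. pos_class n (b j)) ` {i<..n}" "{0..<int n}"] by auto
  note sub = free_classes_subset[of n b i]
  have eq: "b i = (if 0 < l i then kth_positive {p. pos_class n p \<in> ?K} (l i)
      else largest_nonpositive {p. pos_class n p \<in> ?K})"
    unfolding b_def by (subst placed_bead_eq[OF n]) (simp add: Let_def)
  have "pos_class n (b i) \<in> ?K \<and> class_count n ?K (b i) = l i \<and> 1 - int n \<le> b i \<and>
      (0 < l i \<longleftrightarrow> 0 < b i) \<and> (\<forall>q. l i = 0 \<longrightarrow> pos_class n q \<in> ?K \<longrightarrow> q \<le> 0 \<longrightarrow> q \<le> b i)"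
  proof (cases "0 < l i")
    case True
    then show ?thesis using kth_positive_spec[OF n sub ne True] eq n by auto
  next
    case False
    then show ?thesis
      using largest_nonpositive_spec[OF n sub ne] eq by (auto simp: class_count_nonpos)
  qed
  then show "pos_class n (b i) \<in> free_classes n b i" "class_count n (free_classes n b i) (b i) = l i"
    "1 - int n \<le> b i" "0 < l i \<longleftrightarrow> 0 < b i"
    "\<And>q. l i = 0 \<Longrightarrow> pos_class n q \<in> free_classes n b i \<Longrightarrow> q \<le> 0 \<Longrightarrow> q \<le> b i"
    by blast+
qed

lemma placed_bead_sequence:
  assumes n: "0 < n" and l: "l \<in> lecture_hall n"
  shows "bead_sequence n (placed_bead n l)"
proof -
  let ?b = "placed_bead n l"
  note spec = placed_bead_spec[OF n, of _ l]
  have inj: "inj_on (\<lambda>i. pos_class n (?b i)) {1..n}"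
  proof (rule linorder_inj_onI')
    fix i j assume "i \<in> {1..n}" "j \<in> {1..n}" "i < j"
    then show "pos_class n (?b i) \<noteq> pos_class n (?b j)"
      using spec(1)[of i] unfolding free_classes_def by fastforce
  qed
  have bij: "bij_betw (\<lambda>i. pos_class n (?b i)) {1..n} {0..<int n}"
    unfolding bij_betw_def
  proof (intro conjI inj card_subset_eq)
    show "(\<lambda>i. pos_class n (?b i)) ` {1..n} \<subseteq> {0..<int n}" using pos_class_range[OF n] by blast
    show "card ((\<lambda>i. pos_class n (?b i)) ` {1..n}) = card {0..<int n}"
      using inj by (simp add: card_image)
  qed simp
  have step: "?b i < ?b (Suc i)" if i: "1 \<le> i" "Suc i \<le> n" for i
  proof (rule ccontr)
    assume "\<not> ?b i < ?b (Suc i)"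
    moreover have "?b i \<noteq> ?b (Suc i)"
      using inj_onD[OF inj, of i "Suc i"] i by auto
    ultimately have gt: "?b (Suc i) < ?b i" by simp
    have free: "free_classes n ?b i = free_classes n ?b (Suc i) - {pos_class n (?b (Suc i))}"
      using free_classes_Suc[OF i(2)] .
    have "l i * Suc i \<le> l (Suc i) * i" using l i unfolding lecture_hall_iff by blast
    \<comment> \<open>Deleting the class of bead \<open>Suc i\<close> turns the lecture hall
      inequality into a lower bound on the rank of that bead among the classes free for bead
      \<open>i\<close>. If bead \<open>i\<close> came later, its own rank would exceed
      \<open>l i\<close>.\<close>
    then have le: "l i \<le> class_count n (free_classes n ?b i) (?b (Suc i))"
      using class_count_delete_iff[OF n free_classes_subset spec(1)[of "Suc i"], of "l i"]
        card_free_classes[OF inj n i(2)] spec(2)[of "Suc i"] i free by simp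
    show False
    proof (cases "0 < l i")
      case True
      then show False
        using class_count_strict_mono[OF gt, of n "free_classes n ?b i"] spec(1,2,4)[of i] le i by simp
    next
      case False
      \<comment> \<open>Ranks do not separate non-positive beads. Here bead \<open>Suc i\<close> was
        the largest non-positive choice from a larger set of classes, so bead \<open>i\<close>
        cannot lie beyond it.\<close>
      then have "?b (Suc i) < 0" using spec(4)[of i] gt i by simp
      then have "l (Suc i) = 0" using spec(4)[of "Suc i"] i by simp
      then show False
        using spec(5)[of "Suc i" "?b i"] spec(1)[of i] spec(4)[of i] False gt i free by simp
    qed
  qed
  have "strict_mono_on {1..n} ?b"
  proof (rule strict_mono_onI)
    fix i j assume ij: "i \<in> {1..n}" "j \<in> {1..n}" "i < j"
    have "?b i < ?b (i + Suc k)" if "i + Suc k \<le> n" for k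
      using that
    proof (induction k)
      case 0
      then show ?case using step[of i] ij by simp
    next
      case (Suc k)
      then show ?case using step[of "i + Suc k"] by simp
    qed
    from this[of "j - Suc i"] ij show "?b i < ?b j" by simp
  qed
  then show ?thesis unfolding bead_sequence_def using bij spec(3) by simp
qed

text \<open>All \<open>n\<close> labels are used exactly once, so those not taken by beads above
  \<open>i\<close> belong to beads \<open>1..i\<close>. This identifies availability with having
  class at most \<open>i\<close>.\<close>

lemma bead_sequence_free_classes:
  assumes "bead_sequence n b" "i \<le> n"
  shows "free_classes n b i = (\<lambda>j. pos_class n (b j)) ` {1..i}"
proof -
  have inj: "inj_on (\<lambda>i. pos_class n (b i)) {1..n}"
    and im: "{0..<int n} = (\<lambda>i. pos_class n (b i)) ` {1..n}"
    using assms(1) unfolding bead_sequence_def bij_betw_def by auto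
  have eq: "{1..i} = {1..n} - {i<..n}" using assms(2) by auto
  have "(\<lambda>i. pos_class n (b i)) ` {1..i} =
      (\<lambda>i. pos_class n (b i)) ` {1..n} - (\<lambda>i. pos_class n (b i)) ` {i<..n}"
    unfolding eq by (rule inj_on_image_set_diff[OF inj]) auto
  then show ?thesis unfolding free_classes_def im by (rule sym)
qed

text \<open>The candidate inverse on the level of bead sequences; the restriction makes it
  extensional, as \<open>lecture_hall\<close> demands.\<close>

definition active_counts :: "nat \<Rightarrow> (nat \<Rightarrow> int) \<Rightarrow> nat \<Rightarrow> nat" where
  "active_counts n b = (\<lambda>i\<in>{1..n}. class_count n (free_classes n b i) (b i))"

text \<open>Since \<open>b i < b (Suc i)\<close>, the rank of \<open>b i\<close> is at most that of
  \<open>b (Suc i)\<close> once the class of the latter is deleted;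
  \<open>class_count_delete_iff\<close> converts this into the lecture hall inequality.\<close>

lemma active_counts_lecture_hall:
  assumes n: "0 < n" and b: "bead_sequence n b"
  shows "active_counts n b \<in> lecture_hall n"
  unfolding lecture_hall_iff
proof (intro conjI allI impI)
  fix i assume i: "1 \<le> i" "Suc i \<le> n"
  have inj: "inj_on (\<lambda>i. pos_class n (b i)) {1..n}"
    using b unfolding bead_sequence_def bij_betw_def by simp
  have "b i < b (Suc i)"
    using b i unfolding bead_sequence_def by (auto intro: strict_mono_onD)
  then have "class_count n (free_classes n b i) (b i) \<le> class_count n (free_classes n b i) (b (Suc i))"
    by (intro class_count_mono) simp
  moreover have "pos_class n (b (Suc i)) \<in> free_classes n b (Suc i)"
    using bead_sequence_free_classes[OF b i(2)] by auto
  ultimately show "active_counts n b i * Suc i \<le> active_counts n b (Suc i) * i"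
    using class_count_delete_iff[OF n free_classes_subset, of "b (Suc i)" b "Suc i" "active_counts n b i"]
      free_classes_Suc[OF i(2), of b] card_free_classes[OF inj n i(2)] i
    by (simp add: active_counts_def)
qed (simp add: active_counts_def)

text \<open>Downward induction: if all later beads agree, so do the free classes, and a positive
  \<open>b i\<close> is recovered from its rank. A non-positive \<open>b i\<close> must be shown to
  be the largest non-positive available position.\<close>

lemma placed_bead_active_counts:
  assumes n: "0 < n" and b: "bead_sequence n b"
  shows "1 \<le> i \<Longrightarrow> i \<le> n \<Longrightarrow> placed_bead n (active_counts n b) i = b i"
proof (induction "n - i" arbitrary: i rule: less_induct)
  case less
  let ?K = "free_classes n b i" and ?l = "active_counts n b"
  have "placed_bead n ?l j = b j" if "j \<in> {i<..n}" for j
    using less.hyps[of j] less.prems that by auto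
  then have K: "free_classes n (placed_bead n ?l) i = ?K"
    unfolding free_classes_def by simp
  have eq: "placed_bead n ?l i = (if 0 < ?l i then kth_positive {p. pos_class n p \<in> ?K} (?l i)
      else largest_nonpositive {p. pos_class n p \<in> ?K})"
    by (subst placed_bead_eq[OF n]) (simp only: Let_def K)
  have K': "?K = (\<lambda>j. pos_class n (b j)) ` {1..i}"
    using bead_sequence_free_classes[OF b less.prems(2)] .
  then have bi: "pos_class n (b i) \<in> ?K" using less.prems by auto
  have li: "?l i = class_count n ?K (b i)" using less.prems by (simp add: active_counts_def)
  show ?case
  proof (cases "0 < b i")
    case True
    then have "0 < ?l i"
      using class_count_strict_mono[OF True True bi] li by simp
    then show ?thesis using eq li kth_positive_eqI[OF bi True] by simp
  next
    case False
    then have "?l i = 0" using li by (simp add: class_count_nonpos)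
    moreover have "largest_nonpositive {p. pos_class n p \<in> ?K} = b i"
    proof (rule largest_nonpositive_eqI)
      fix q assume "q \<in> {p. pos_class n p \<in> ?K}" "q \<le> 0"
      then obtain j where j: "j \<in> {1..i}" "pos_class n q = pos_class n (b j)" using K' by auto
      have "b j \<le> b i"
        using b j less.prems unfolding bead_sequence_def by (auto intro: strict_mono_on_leD)
      \<comment> \<open>A \<open>q\<close> beyond \<open>b i\<close> would lie with
        \<open>b j\<close> in the block \<open>{1 - n..0}\<close>, where a class occurs only once,
        so \<open>q = b j \<le> b i\<close>.\<close>
      show "q \<le> b i"
      proof (rule ccontr)
        assume "\<not> q \<le> b i"
        moreover have "1 - int n \<le> b j"
          using b j(1) less.prems unfolding bead_sequence_def by simp
        ultimately have "q \<in> {- int n<..0}" "b j \<in> {- int n<..0}"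
          using \<open>b j \<le> b i\<close> \<open>q \<le> 0\<close> False by simp_all
        moreover have "inj_on (pos_class n) {- int n<..0}"
          using bij_betw_imp_inj_on[OF pos_class_block[OF n, of "-1"]] by simp
        ultimately have "q = b j" using j(2) by (auto dest: inj_onD)
        then show False using \<open>b j \<le> b i\<close> \<open>\<not> q \<le> b i\<close> by simp
      qed
    qed (use bi False in auto)
    ultimately show ?thesis using eq by simp
  qed
qed

section \<open>Abacus diagrams as reflecting transversals\<close>

text \<open>If \<open>t\<close> is the lowest bead of a column, then \<open>t + 2 n\<close> is a gap, so that balancedness makes
  \<open>1 - 2 n - t\<close> the lowest bead of the dual column.  An abacus diagram is thus determined by a
  transversal of the columns that is closed under \<open>t \<mapsto> 1 - 2 n - t\<close>.\<close>

definition reflecting_transversal :: "nat \<Rightarrow> int set \<Rightarrow> bool" where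
  "reflecting_transversal n T \<longleftrightarrow>
     (\<forall>p. \<exists>!t. t \<in> T \<and> column n t = column n p) \<and> (\<forall>t\<in>T. 1 - 2 * int n - t \<in> T)"

definition beads_above :: "nat \<Rightarrow> int set \<Rightarrow> int set" where
  "beads_above n T = (\<Union>t\<in>T. up_column n t)"

lemma mem_beads_above: "p \<in> beads_above n T \<longleftrightarrow> (\<exists>t\<in>T. column n t = column n p \<and> p \<le> t)"
  unfolding beads_above_def up_column_def by fastforce

lemma mem_beads_above_iff:
  assumes "reflecting_transversal n T" "t \<in> T" "column n t = column n p"
  shows "p \<in> beads_above n T \<longleftrightarrow> p \<le> t"
  using assms unfolding mem_beads_above reflecting_transversal_def by metis

lemma column_less_imp_add_le:
  assumes "column n p = column n q" "p < q"
  shows "p + 2 * int n \<le> q"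
  using assms zdvd_imp_le[of "2 * int n" "q - p"] unfolding column_eq_iff
  by (simp add: dvd_diff_commute)

lemma column_diff_period: "column n (p - 2 * int n) = column n p"
  by (simp add: column_eq_iff)

lemma column_reflect_eq:
  "column n p = column n q \<Longrightarrow> column n (1 - 2 * int n - p) = column n (1 - q)"
proof -
  assume "column n p = column n q"
  then have "2 * int n dvd q - p - 2 * int n"
    unfolding column_eq_iff by (simp add: dvd_diff_commute)
  then show ?thesis unfolding column_eq_iff by (simp add: algebra_simps)
qed

lemma lowest_beads_above:
  assumes T: "reflecting_transversal n T"
  shows "lowest_beads n (beads_above n T) = T"
proof (intro equalityI subsetI)
  fix p assume p: "p \<in> lowest_beads n (beads_above n T)"
  then obtain t where t: "t \<in> T" "column n t = column n p" "p \<le> t"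
    unfolding lowest_beads_def mem_beads_above by auto
  have "t \<in> beads_above n T" using t(1) unfolding mem_beads_above by auto
  then have "t \<le> p" using p t(2) unfolding lowest_beads_def by auto
  then show "p \<in> T" using t by simp
next
  fix t assume t: "t \<in> T"
  then show "t \<in> lowest_beads n (beads_above n T)"
    unfolding lowest_beads_def using mem_beads_above_iff[OF T t] by auto
qed

lemma beads_above_abacus:
  assumes n: "0 < n" and T: "reflecting_transversal n T"
  shows "beads_above n T \<in> abacus_diagrams n"
proof -
  have ex: "\<exists>t\<in>T. column n t = column n p" for p
    using T unfolding reflecting_transversal_def by blast
  have "flush n (beads_above n T)"
    unfolding flush_def mem_beads_above column_diff_period by fastforce
  moreover have "balanced (beads_above n T)"
    unfolding balanced_def
  proof
    fix p
    obtain t where t: "t \<in> T" "column n t = column n p" using ex by blast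
    have t': "1 - 2 * int n - t \<in> T" using T t(1) unfolding reflecting_transversal_def by blast
    \<comment> \<open>The right side says \<open>p < t + 2n\<close>; positions of one column are
      \<open>2n\<close> apart, so this amounts to \<open>p \<le> t\<close>.\<close>
    have "p \<le> t \<longleftrightarrow> \<not> 1 - p \<le> 1 - 2 * int n - t"
      using column_less_imp_add_le[of n t p] t(2) n by linarith
    then show "p \<in> beads_above n T \<longleftrightarrow> 1 - p \<notin> beads_above n T"
      using mem_beads_above_iff[OF T t] mem_beads_above_iff[OF T t' column_reflect_eq[OF t(2)]] by simp
  qed
  moreover have "\<forall>c\<in>{1..2 * int n}. \<exists>p\<in>lowest_beads n (beads_above n T). column n p = c"
    unfolding lowest_beads_above[OF T] using ex column_id by metis
  ultimately show ?thesis unfolding abacus_diagrams_def by blast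
qed

lemma flush_column_le:
  assumes "0 < n" "flush n B" "p \<in> B" "column n q = column n p" "q \<le> p"
  shows "q \<in> B"
proof -
  have iter: "p - 2 * int n * int k \<in> B" for k
  proof (induction k)
    case 0
    then show ?case using assms(3) by simp
  next
    case (Suc k)
    then have "p - 2 * int n * int k - 2 * int n \<in> B" using assms(2) unfolding flush_def by blast
    then show ?case by (simp add: algebra_simps)
  qed
  obtain d where d: "p - q = 2 * int n * d"
    using assms(4) unfolding column_eq_iff dvd_diff_commute[of _ q] by (auto elim: dvdE)
  then have "0 \<le> 2 * int n * d" using assms(5) by linarith
  then have "0 \<le> d" using assms(1) by (simp add: zero_le_mult_iff)
  then show ?thesis using iter[of "nat d"] d by (simp add: algebra_simps)
qed

lemma abacus_lowest_beads:
  assumes n: "0 < n" and B: "B \<in> abacus_diagrams n"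
  shows "reflecting_transversal n (lowest_beads n B)" "beads_above n (lowest_beads n B) = B"
proof -
  have flush: "flush n B" and bal: "\<And>j. j \<in> B \<longleftrightarrow> 1 - j \<notin> B"
    and low: "\<And>p. \<exists>t\<in>lowest_beads n B. column n t = column n p"
    using B column_range[OF n] unfolding abacus_diagrams_def balanced_def by blast+
  have "\<exists>!t. t \<in> lowest_beads n B \<and> column n t = column n p" for p
  proof (rule ex_ex1I)
    show "\<exists>t. t \<in> lowest_beads n B \<and> column n t = column n p" using low by blast
  qed (auto simp: lowest_beads_def intro!: antisym)
  moreover have "1 - 2 * int n - t \<in> lowest_beads n B" if t: "t \<in> lowest_beads n B" for t
    unfolding lowest_beads_def
  proof (intro CollectI conjI ballI impI)
    have "column n (t + 2 * int n) = column n t"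
      using column_diff_period[of n "t + 2 * int n"] by simp
    then have "t + 2 * int n \<notin> B" using t n unfolding lowest_beads_def by force
    then show "1 - 2 * int n - t \<in> B" using bal[of "t + 2 * int n"] by (simp add: algebra_simps)
  next
    fix q assume q: "q \<in> B" "column n q = column n (1 - 2 * int n - t)"
    show "q \<le> 1 - 2 * int n - t"
    proof (rule ccontr)
      assume "\<not> q \<le> 1 - 2 * int n - t"
      \<comment> \<open>The next position of the dual column after \<open>1 - 2n - t\<close> is
        \<open>1 - t\<close>. By flushness it would be a bead, although \<open>t\<close> is
        one.\<close>
      then have "1 - t \<le> q" using column_less_imp_add_le[of n "1 - 2 * int n - t" q] q(2) by simp
      moreover have "column n (1 - t) = column n q" using q(2) column_reflect_eq[of n t t] by simp
      ultimately have "1 - t \<in> B" using flush_column_le[OF n flush q(1)] by simp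
      then show False using bal[of t] t unfolding lowest_beads_def by simp
    qed
  qed
  ultimately show "reflecting_transversal n (lowest_beads n B)"
    unfolding reflecting_transversal_def by blast
  show "beads_above n (lowest_beads n B) = B"
  proof (intro equalityI subsetI)
    fix p assume "p \<in> beads_above n (lowest_beads n B)"
    then show "p \<in> B"
      using flush_column_le[OF n flush] unfolding mem_beads_above lowest_beads_def by auto
  next
    fix p assume p: "p \<in> B"
    obtain t where "t \<in> lowest_beads n B" "column n t = column n p" using low by blast
    with p show "p \<in> beads_above n (lowest_beads n B)"
      unfolding mem_beads_above lowest_beads_def by auto
  qed
qed

section \<open>Defining beads as the upper half of a transversal\<close>

definition upper_half :: "nat \<Rightarrow> int set \<Rightarrow> int set" where
  "upper_half n T = {t \<in> T. 1 - int n \<le> t}"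

lemma transversal_upper_half:
  assumes n: "0 < n" and T: "reflecting_transversal n T"
  shows "bij_betw (pos_class n) (upper_half n T) {0..<int n}"
    "T = upper_half n T \<union> (\<lambda>t. 1 - 2 * int n - t) ` upper_half n T"
proof -
  have refl: "1 - 2 * int n - t \<in> T" if "t \<in> T" for t
    using T that unfolding reflecting_transversal_def by blast
  have uniq: "s = t" if "s \<in> T" "t \<in> T" "column n s = column n t" for s t
    using T that unfolding reflecting_transversal_def by metis
  show T_eq: "T = upper_half n T \<union> (\<lambda>t. 1 - 2 * int n - t) ` upper_half n T" (is "_ = ?U")
  proof
    show "T \<subseteq> ?U"
    proof
      fix t assume t: "t \<in> T"
      show "t \<in> ?U"
      proof (cases "1 - int n \<le> t")
        case False
        then have "1 - 2 * int n - t \<in> upper_half n T"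
          using refl[OF t] unfolding upper_half_def by simp
        moreover have "t = 1 - 2 * int n - (1 - 2 * int n - t)" by simp
        ultimately show ?thesis by blast
      qed (use t in \<open>simp add: upper_half_def\<close>)
    qed
    show "?U \<subseteq> T" using refl unfolding upper_half_def by auto
  qed
  have "inj_on (pos_class n) (upper_half n T)"
  proof (rule inj_onI)
    fix s t assume st: "s \<in> upper_half n T" "t \<in> upper_half n T" "pos_class n s = pos_class n t"
    then have "column n s = column n t \<or> column n s = column n (1 - 2 * int n - t)"
      using pos_class_eq_iff[OF n] dual_column_column[OF n] by simp
    then have "s = t \<or> s = 1 - 2 * int n - t"
      using st uniq refl unfolding upper_half_def by blast
    \<comment> \<open>The alternative \<open>s + t = 1 - 2n\<close> fails because both are at least
      \<open>1 - n\<close>.\<close>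
    then show "s = t" using st unfolding upper_half_def by auto
  qed
  moreover have "{0..<int n} \<subseteq> pos_class n ` upper_half n T"
  proof
    fix c assume "c \<in> {0..<int n}"
    then obtain p where p: "c = pos_class n p"
      using bij_betw_imp_surj_on[OF pos_class_block[OF n, of 0]] by blast
    obtain t where t: "t \<in> T" "column n t = column n p"
      using T unfolding reflecting_transversal_def by blast
    then have "c = pos_class n t" using p pos_class_eq_iff[OF n] by simp
    moreover have "pos_class n t \<in> pos_class n ` upper_half n T"
      using t(1) pos_class_reflect[OF n] by (subst (asm) T_eq) auto
    ultimately show "c \<in> pos_class n ` upper_half n T" by simp
  qed
  ultimately show "bij_betw (pos_class n) (upper_half n T) {0..<int n}"
    unfolding bij_betw_def using pos_class_range[OF n] by blast
qed

lemma transversal_from_upper_half: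
  assumes n: "0 < n" and D: "bij_betw (pos_class n) D {0..<int n}" "\<And>t. t \<in> D \<Longrightarrow> 1 - int n \<le> t"
  defines "T \<equiv> D \<union> (\<lambda>t. 1 - 2 * int n - t) ` D"
  shows "reflecting_transversal n T" "upper_half n T = D"
proof -
  have cls: "pos_class n s = pos_class n t" if "column n s = column n t" for s t
    using that pos_class_eq_iff[OF n] by simp
  \<comment> \<open>No column is its own dual: \<open>1 - 2n - 2t\<close> is odd and the period
    \<open>2n\<close> is even.\<close>
  have parity: "column n (1 - 2 * int n - t) \<noteq> column n t" for t
  proof
    assume "column n (1 - 2 * int n - t) = column n t"
    then have "even (1 - 2 * int n - t - t)"
      unfolding column_eq_iff by (metis dvd_mult_left)
    then show False by simp
  qed
  have ex: "\<exists>t. t \<in> T \<and> column n t = column n p" for p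
  proof -
    obtain t where t: "t \<in> D" "pos_class n t = pos_class n p"
      using bij_betw_imp_surj_on[OF D(1)] pos_class_range[OF n, of p] by (metis imageE)
    then have "pos_class n p = pos_class n t" by simp
    then have "column n p = column n t \<or> column n p = column n (1 - 2 * int n - t)"
      using pos_class_eq_iff[OF n] dual_column_column[OF n] by simp
    moreover have "t \<in> T" "1 - 2 * int n - t \<in> T" using t(1) unfolding T_def by auto
    ultimately show ?thesis by metis
  qed
  have uniq: "s = t" if st: "s \<in> T" "t \<in> T" "column n s = column n t" for s t
  proof -
    obtain s' where s': "s' \<in> D" "s = s' \<or> s = 1 - 2 * int n - s'" using st(1) T_def by auto
    obtain t' where t': "t' \<in> D" "t = t' \<or> t = 1 - 2 * int n - t'" using st(2) T_def by auto
    have "pos_class n s' = pos_class n t'"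
      using cls[OF st(3)] s'(2) t'(2) pos_class_reflect[OF n] by auto
    then have "s' = t'" using D(1) s'(1) t'(1) unfolding bij_betw_def by (auto dest: inj_onD)
    then show ?thesis using s'(2) t'(2) st(3) parity[of s'] by metis
  qed
  show "reflecting_transversal n T"
    unfolding reflecting_transversal_def
  proof (intro conjI allI ballI ex_ex1I)
    fix t assume "t \<in> T"
    then show "1 - 2 * int n - t \<in> T" unfolding T_def by force
  qed (use ex uniq in auto)
  show "upper_half n T = D"
    unfolding upper_half_def T_def using D(2) by fastforce
qed

lemma finite_upper_half:
  assumes "0 < n" "reflecting_transversal n T"
  shows "finite (upper_half n T)" "card (upper_half n T) = n"
proof -
  note bij = transversal_upper_half(1)[OF assms]
  show "finite (upper_half n T)" using bij_betw_finite[OF bij] by simp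
  show "card (upper_half n T) = n" using bij_betw_same_card[OF bij] by simp
qed

text \<open>The upper half has \<open>n\<close> elements and lies above the rest. Its members
  therefore have fewer than \<open>n\<close> larger lowest beads, all others at least
  \<open>n\<close>.\<close>

lemma defining_beads_upper_half:
  assumes n: "0 < n" and T: "reflecting_transversal n (lowest_beads n B)"
  shows "defining_beads n B = upper_half n (lowest_beads n B)"
proof -
  let ?T = "lowest_beads n B" and ?D = "upper_half n (lowest_beads n B)"
  note D = finite_upper_half[OF n T]
  have "finite ?T" using D(1) by (subst transversal_upper_half(2)[OF n T]) simp
  have "card {q \<in> ?T. p < q} < n \<longleftrightarrow> 1 - int n \<le> p" if p: "p \<in> ?T" for p
  proof
    assume "1 - int n \<le> p"
    then have "p \<in> ?D" "p \<notin> {q \<in> ?T. p < q}" "{q \<in> ?T. p < q} \<subseteq> ?D"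
      using p unfolding upper_half_def by auto
    then have "{q \<in> ?T. p < q} \<subset> ?D" by blast
    then show "card {q \<in> ?T. p < q} < n" using psubset_card_mono D by metis
  next
    assume less: "card {q \<in> ?T. p < q} < n"
    show "1 - int n \<le> p"
    proof (rule ccontr)
      assume "\<not> 1 - int n \<le> p"
      then have "?D \<subseteq> {q \<in> ?T. p < q}" unfolding upper_half_def by auto
      then have "n \<le> card {q \<in> ?T. p < q}"
        using card_mono[of "{q \<in> ?T. p < q}" ?D] \<open>finite ?T\<close> D(2) by simp
      then show False using less by simp
    qed
  qed
  then show ?thesis unfolding defining_beads_def upper_half_def by blast
qed

section \<open>Correspondence between bead sequences and diagrams\<close>

lemma sorted_list_of_strict_mono_image:
  fixes b :: "nat \<Rightarrow> 'a::linorder"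
  assumes "strict_mono_on {1..n} b" "i \<in> {1..n}"
  shows "sorted_list_of_set (b ` {1..n}) ! (i - 1) = b i"
proof -
  let ?xs = "map b [1..<Suc n]"
  have "sorted_wrt (<) ?xs"
    using assms(1) by (auto simp: sorted_wrt_iff_nth_less simp del: upt_Suc intro: strict_mono_onD)
  then have "sorted_list_of_set (set ?xs) = ?xs"
    using sorted_list_of_set.idem_if_sorted_distinct strict_sorted_iff by blast
  moreover have "set ?xs = b ` {1..n}" by auto
  moreover have "?xs ! (i - 1) = b i" using assms(2) by (subst nth_map) (auto simp del: upt_Suc)
  ultimately show ?thesis by (simp only:)
qed

lemma sorted_list_of_set_strict_mono:
  fixes D :: "'a::linorder set"
  assumes "finite D" "card D = n"
  defines "b \<equiv> \<lambda>i. sorted_list_of_set D ! (i - 1)"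
  shows "strict_mono_on {1..n} b" "b ` {1..n} = D"
proof -
  have len: "length (sorted_list_of_set D) = n" using assms by simp
  show "strict_mono_on {1..n} b"
  proof (rule strict_mono_onI)
    fix i j assume "i \<in> {1..n}" "j \<in> {1..n}" "i < j"
    then show "b i < b j"
      unfolding b_def using len by (intro sorted_wrt_nth_less[OF strict_sorted_list_of_set]) auto
  qed
  have "D = (\<lambda>i. sorted_list_of_set D ! i) ` {0..<n}"
    using set_sorted_list_of_set[OF assms(1)] len nth_image[of n "sorted_list_of_set D"] by simp
  also have "\<dots> = b ` Suc ` {0..<n}" unfolding image_image b_def by simp
  also have "Suc ` {0..<n} = {1..n}" by (auto simp: image_Suc_atLeastLessThan)
  finally show "b ` {1..n} = D" by simp
qed

text \<open>Generalizes \<open>abacus_of\<close> to an arbitrary sequence of beads and depends only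
  on its set of values on \<open>{1..n}\<close>.\<close>

definition beads_of_sequence :: "nat \<Rightarrow> (nat \<Rightarrow> int) \<Rightarrow> int set" where
  "beads_of_sequence n b = beads_above n (b ` {1..n} \<union> (\<lambda>t. 1 - 2 * int n - t) ` b ` {1..n})"

lemma abacus_of_eq: "abacus_of n l = beads_of_sequence n (placed_bead n l)"
  unfolding abacus_of_def beads_of_sequence_def beads_above_def by auto

text \<open>Closing the beads under reflection gives a transversal with the original beads as upper
  half, so sorting its defining beads returns the sequence.\<close>

lemma bead_sequence_abacus:
  assumes n: "0 < n" and b: "bead_sequence n b"
  shows "beads_of_sequence n b \<in> abacus_diagrams n"
    "\<And>i. i \<in> {1..n} \<Longrightarrow> defining_bead n (beads_of_sequence n b) i = b i"
proof -
  let ?D = "b ` {1..n}"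
  have mono: "strict_mono_on {1..n} b" using b unfolding bead_sequence_def by simp
  have "bij_betw (pos_class n) ?D {0..<int n}"
  proof -
    have "bij_betw (pos_class n \<circ> b) {1..n} {0..<int n}"
      using b unfolding bead_sequence_def comp_def by blast
    then have "inj_on (pos_class n) ?D" "pos_class n ` ?D = {0..<int n}"
      unfolding bij_betw_def by (blast intro: inj_on_imageI, metis image_comp)
    then show ?thesis by (simp add: bij_betw_def)
  qed
  moreover have "1 - int n \<le> t" if "t \<in> ?D" for t
    using b that unfolding bead_sequence_def by auto
  ultimately have T: "reflecting_transversal n (?D \<union> (\<lambda>t. 1 - 2 * int n - t) ` ?D)"
    and up: "upper_half n (?D \<union> (\<lambda>t. 1 - 2 * int n - t) ` ?D) = ?D"
    using transversal_from_upper_half[OF n] by blast+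
  show "beads_of_sequence n b \<in> abacus_diagrams n"
    unfolding beads_of_sequence_def by (rule beads_above_abacus[OF n T])
  have "defining_beads n (beads_of_sequence n b) = ?D"
    unfolding beads_of_sequence_def
    using defining_beads_upper_half[OF n, of "beads_above n (?D \<union> (\<lambda>t. 1 - 2 * int n - t) ` ?D)"]
      T up lowest_beads_above[OF T] by simp
  then show "defining_bead n (beads_of_sequence n b) i = b i" if "i \<in> {1..n}" for i
    unfolding defining_bead_def using sorted_list_of_strict_mono_image[OF mono that] by simp
qed

text \<open>Conversely, the lowest beads are the upper half together with its reflection, and they
  determine the diagram.\<close>

lemma abacus_bead_sequence:
  assumes n: "0 < n" and B: "B \<in> abacus_diagrams n"
  shows "bead_sequence n (defining_bead n B)" "beads_of_sequence n (defining_bead n B) = B"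
proof -
  note T = abacus_lowest_beads[OF n B]
  let ?D = "upper_half n (lowest_beads n B)"
  have d: "defining_bead n B = (\<lambda>i. sorted_list_of_set ?D ! (i - 1))"
    unfolding defining_bead_def defining_beads_upper_half[OF n T(1)] ..
  have mono: "strict_mono_on {1..n} (defining_bead n B)" and im: "defining_bead n B ` {1..n} = ?D"
    unfolding d using sorted_list_of_set_strict_mono[OF finite_upper_half[OF n T(1)]] .
  have "inj_on (defining_bead n B) {1..n}" using mono by (rule strict_mono_on_imp_inj_on)
  then have "bij_betw (defining_bead n B) {1..n} ?D" using im by (simp add: bij_betw_def)
  then have "bij_betw (pos_class n \<circ> defining_bead n B) {1..n} {0..<int n}"
    using transversal_upper_half(1)[OF n T(1)] by (rule bij_betw_trans)
  moreover have "1 - int n \<le> defining_bead n B i" if "i \<in> {1..n}" for i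
    using im that unfolding upper_half_def by auto
  ultimately show "bead_sequence n (defining_bead n B)"
    unfolding bead_sequence_def using mono by (simp add: comp_def)
  show "beads_of_sequence n (defining_bead n B) = B"
    unfolding beads_of_sequence_def im transversal_upper_half(2)[OF n T(1), symmetric] by (rule T(2))
qed

section \<open>Active positions and the inverse map\<close>

lemma card_active:
  assumes n: "0 < n" and B: "B \<in> abacus_diagrams n"
  shows "(\<lambda>i\<in>{1..n}. card {p. active n B i p}) = active_counts n (defining_bead n B)"
  unfolding active_counts_def
proof (rule restrict_ext)
  fix i assume i: "i \<in> {1..n}"
  have "active n B i p \<longleftrightarrow> pos_class n p \<in> free_classes n (defining_bead n B) i \<and>
      0 < p \<and> p \<le> defining_bead n B i" for p
    using i bead_sequence_free_classes[OF abacus_bead_sequence(1)[OF n B], of i]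
    unfolding active_def has_class_def pos_class_eq_iff[OF n, symmetric] by auto
  then show "card {p. active n B i p} =
      class_count n (free_classes n (defining_bead n B) i) (defining_bead n B i)"
    unfolding class_count_def by simp
qed

theorem theorem2p3:
  fixes n :: nat
  assumes "0 < n"
  shows "bij_betw (abacus_of n) (lecture_hall n) (abacus_diagrams n) \<and>
    (\<forall>B\<in>abacus_diagrams n.
       inv_into (lecture_hall n) (abacus_of n) B = (\<lambda>i\<in>{1..n}. card {p. active n B i p}))"
proof -
  let ?g = "\<lambda>B. active_counts n (defining_bead n B)"
  have f_in: "abacus_of n l \<in> abacus_diagrams n" if "l \<in> lecture_hall n" for l
    unfolding abacus_of_eq
    using bead_sequence_abacus(1)[OF assms placed_bead_sequence[OF assms that]] .
  have g_in: "?g B \<in> lecture_hall n" if "B \<in> abacus_diagrams n" for B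
    using active_counts_lecture_hall[OF assms abacus_bead_sequence(1)[OF assms that]] .
  have gf: "?g (abacus_of n l) = l" if l: "l \<in> lecture_hall n" for l
  proof
    fix i
    note b = bead_sequence_abacus(2)[OF assms placed_bead_sequence[OF assms l], folded abacus_of_eq]
    show "?g (abacus_of n l) i = l i"
    proof (cases "i \<in> {1..n}")
      case True
      have "free_classes n (defining_bead n (abacus_of n l)) i = free_classes n (placed_bead n l) i"
        unfolding free_classes_def using b by simp
      then show ?thesis
        using True b[OF True] placed_bead_spec(2)[OF assms, of i l] by (simp add: active_counts_def)
    next
      case False
      \<comment> \<open>Outside \<open>{1..n}\<close> both functions take the default value
        \<open>undefined\<close>.\<close>
      have "l \<in> extensional {1..n}" using l unfolding lecture_hall_iff by blast
      then have "l i = undefined" using False by (rule extensional_arb)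
      with False show ?thesis unfolding active_counts_def by (simp only: restrict_apply if_False)
    qed
  qed
  have fg: "abacus_of n (?g B) = B" if B: "B \<in> abacus_diagrams n" for B
  proof -
    \<comment> \<open>Agreement on \<open>{1..n}\<close> suffices, as the diagram depends only on
      the image of this set.\<close>
    have "placed_bead n (?g B) ` {1..n} = defining_bead n B ` {1..n}"
      using placed_bead_active_counts[OF assms abacus_bead_sequence(1)[OF assms B]]
      by (intro image_cong) auto
    then show ?thesis
      using abacus_bead_sequence(2)[OF assms B] unfolding abacus_of_eq beads_of_sequence_def by simp
  qed
  have bij: "bij_betw (abacus_of n) (lecture_hall n) (abacus_diagrams n)"
    by (rule bij_betw_byWitness[where f' = ?g]) (use f_in g_in gf fg in auto)
  moreover have "inv_into (lecture_hall n) (abacus_of n) B = (\<lambda>i\<in>{1..n}. card {p. active n B i p})"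
    if "B \<in> abacus_diagrams n" for B
    unfolding card_active[OF assms that]
    using inv_into_f_f[OF bij_betw_imp_inj_on[OF bij] g_in[OF that]] unfolding fg[OF that] .
  ultimately show ?thesis by blast
qed

end
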